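(* For every algorithm $\mathcal{A}$ (in the exploration model described in the context) that successfully explores all finite connected graphs, and for every natural number $n\ge 1$, there is a connected graph $G$ with $n$ vertices such that $\mathcal{A}$ uses at least $n-1$ colors to explore $G$.
   Context: Exploration model. Graphs are finite, simple, undirected and connected; vertices are anonymous and edges carry no port labels. Each vertex carries a color in $\mathbb{N}=\{0,1,2,\dots\}$, where $0$ means "uncolored"; initially all vertices have color $0$. An algorithm is a function $\mathrm{move}$ mapping every environment $(c_0,E)$ — where $c_0\in\mathbb{N}$ is the color of the agent's current vertex and $E:\mathbb{N}\to\mathbb{N}$ (zero almost everywhere) gives, for each color $c$, the number $E(c)$ of neighbors of the current vertex having color $c$ — either to $\mathrm{Stop}$ or to a pair $(c_1,d)\in\mathbb{N}\times\mathbb{N}$ with $E(d)>0$, subject to $c_1=c_0$ whenever $c_0\neq 0$ (a vertex may only be colored while it is uncolored). A run on a graph $G$: an adversary chooses a start vertex $v_0$ and places the agent there; in each step, with the agent at $v$, $\mathrm{move}$ is evaluated at the environment of $v$; if the value is $\mathrm{Stop}$ the run ends, and if it is $(c_1,d)$ then $v$ receives color $c_1$ and the adversary chooses an arbitrary neighbor of $v$ of color $d$, to which the agent moves. The agent has no other memory. A vertex is visited if the agent is located at it in some step. An algorithm successfully explores $G$ if for every adversary (every choice of start vertex and of neighbors), after finitely many steps all vertices have been visited, the agent is at $v_0$, and the decision is $\mathrm{Stop}$. The number of colors used in a run is the number of distinct nonzero colors assigned during the run; $\mathcal{A}$ uses at least $m$ colors to explore $G$ if some run of $\mathcal{A}$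 on $G$ (for some adversary) uses at least $m$ colors. *)

theory Defs
  imports
    "HOL-Library.Extended_Nat"
    "Graph_Theory.Graph_Theory"
begin

datatype decision = Stop | Go nat nat

type_synonym algorithm = "nat \<Rightarrow> (nat \<Rightarrow> nat) \<Rightarrow> decision"

text \<open>
  Environments are pairs of a color and a finitely supported function. Values of an algorithm at
  functions with infinite support are irrelevant: they never arise on a finite graph.
\<close>

definition is_algorithm :: "algorithm \<Rightarrow> bool" where
  "is_algorithm A \<longleftrightarrow>
     (\<forall>c0 E c1 d. finite {c. E c \<noteq> 0} \<longrightarrow> A c0 E = Go c1 d \<longrightarrow>
        E d > 0 \<and> (c0 \<noteq> 0 \<longrightarrow> c1 = c0))"

text \<open>
  Finite connected simple graphs: \<open>pair_graph\<close> is a finite, symmetric, loop-free digraph whose arcs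
  are pairs of vertices; \<open>connected\<close> includes that there is at least one vertex. Every finite
  graph is isomorphic to one whose vertices are natural numbers.
\<close>

definition connected_graph :: "nat pair_pre_digraph \<Rightarrow> bool" where
  "connected_graph G \<longleftrightarrow> pair_graph G \<and> connected (with_proj G)"

text \<open>A configuration consists of the position of the agent and the current coloring.\<close>

type_synonym config = "nat \<times> (nat \<Rightarrow> nat)"

fun decide :: "algorithm \<Rightarrow> nat pair_pre_digraph \<Rightarrow> config \<Rightarrow> decision" where
  "decide A G (v, \<chi>) = A (\<chi> v) (\<lambda>c. card {w. (v, w) \<in> parcs G \<and> \<chi> w = c})"

inductive step :: "algorithm \<Rightarrow> nat pair_pre_digraph \<Rightarrow> config \<Rightarrow> config \<Rightarrow> bool"
  for A G where
  "decide A G (v, \<chi>) = Go c d \<Longrightarrow> (v, w) \<in> parcs G \<Longrightarrow> \<chi> w = d \<Longrightarrow>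
     step A G (v, \<chi>) (w, \<chi>(v := c))"

text \<open>
  \<open>is_run A G r T\<close>: the configurations \<open>r i\<close> with \<open>i \<le> T\<close> form a complete run of \<open>A\<close> on \<open>G\<close> against
  some adversary, i.e. the run either is infinite (\<open>T = \<infinity>\<close>) or ends with the decision \<open>Stop\<close> in
  configuration \<open>r T\<close>. The adversary's choices are resolved by the nondeterminism of \<open>step\<close>, so
  quantifying over adversaries is quantifying over runs. The values \<open>r i\<close> with \<open>i > T\<close> are
  meaningless.
\<close>

definition is_run ::
    "algorithm \<Rightarrow> nat pair_pre_digraph \<Rightarrow> (nat \<Rightarrow> config) \<Rightarrow> enat \<Rightarrow> bool" where
  "is_run A G r T \<longleftrightarrow>
     (\<exists>v0 \<in> pverts G. r 0 = (v0, \<lambda>_. 0)) \<and>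
     (\<forall>i. enat i < T \<longrightarrow> step A G (r i) (r (Suc i))) \<and>
     (\<forall>k. T = enat k \<longrightarrow> decide A G (r k) = Stop)"

definition explores :: "algorithm \<Rightarrow> nat pair_pre_digraph \<Rightarrow> bool" where
  "explores A G \<longleftrightarrow>
     (\<forall>r T. is_run A G r T \<longrightarrow>
        (\<exists>k. T = enat k \<and> decide A G (r k) = Stop \<and> fst (r k) = fst (r 0) \<and>
             (\<forall>v \<in> pverts G. \<exists>i\<le>k. fst (r i) = v)))"

definition colors_used ::
    "algorithm \<Rightarrow> nat pair_pre_digraph \<Rightarrow> (nat \<Rightarrow> config) \<Rightarrow> enat \<Rightarrow> nat set" where
  "colors_used A G r T =
     {c. c \<noteq> 0 \<and> (\<exists>i d. enat i < T \<and> decide A G (r i) = Go c d)}"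

text \<open>
  The subset formulation is \<open>m \<le> card (colors_used A G r T)\<close> for finite runs, and is also right
  when infinitely many colors are assigned, where \<open>card\<close> would be \<open>0\<close>.
\<close>

definition uses_at_least :: "algorithm \<Rightarrow> nat \<Rightarrow> nat pair_pre_digraph \<Rightarrow> bool" where
  "uses_at_least A m G \<longleftrightarrow>
     (\<exists>r T. is_run A G r T \<and> (\<exists>C \<subseteq> colors_used A G r T. finite C \<and> card C = m))"

end

theory Submission
  imports Defs
begin

text \<open>
  In the complete graph on \<open>n\<close> vertices the decisions of the algorithm determine the run up to
  symmetry as long as the agent never reuses a color. The same run can be played on a clique
  with \<open>q < n\<close> vertices, each of which has \<open>n - q\<close> pendant leaves, until the clique is used up: all
  environments agree. If the algorithm stopped early, or reused a color, on the complete graph, it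
  would do so on such a graph, where unvisited leaves remain. Stopping is then wrong, and after
  reusing a color the adversary can exploit that two clique vertices with leaves cannot be told
  apart. So the algorithm uses a new color on each vertex until at most one uncolored vertex is
  left, for otherwise it would run forever.
\<close>

section \<open>Runs\<close>

text \<open>Finite prefixes of runs. The visited set \<open>V\<close> is a separate argument because
  a configuration stores only colors, whereas the later invariants count visited leaves, and a
  visited vertex may stay uncolored.\<close>

definition reaches ::
    "algorithm \<Rightarrow> nat pair_pre_digraph \<Rightarrow> nat \<Rightarrow> config \<Rightarrow> nat set \<Rightarrow> bool" where
  "reaches A G v0 s V \<longleftrightarrow>
     (\<exists>r k. r 0 = (v0, \<lambda>_. 0) \<and> (\<forall>i<k. step A G (r i) (r (Suc i))) \<and> r k = s \<and>
        V = (\<lambda>i. fst (r i)) ` {..k})"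

lemma reaches_start: "reaches A G v0 (v0, \<lambda>_. 0) {v0}"
  unfolding reaches_def
  by (rule exI[of _ "\<lambda>_. (v0, \<lambda>_. 0)"], rule exI[of _ 0]) auto

lemma reaches_step:
  assumes "reaches A G v0 s V" and "step A G s s'"
  shows "reaches A G v0 s' (insert (fst s') V)"
proof -
  from assms(1) obtain r k where r: "r 0 = (v0, \<lambda>_. 0)" "\<forall>i<k. step A G (r i) (r (Suc i))"
    "r k = s" "V = (\<lambda>i. fst (r i)) ` {..k}"
    unfolding reaches_def by blast
  let ?r = "r(Suc k := s')"
  have "insert (fst s') V = (\<lambda>i. fst (?r i)) ` {..Suc k}"
    unfolding atMost_Suc image_insert r(4) by (auto intro!: image_cong)
  moreover have "\<forall>i<Suc k. step A G (?r i) (?r (Suc i))"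
    using r(2,3) assms(2) by (auto simp: less_Suc_eq)
  ultimately show ?thesis
    unfolding reaches_def using r(1) by (intro exI[of _ ?r] exI[of _ "Suc k"]) auto
qed

lemma position_visited: "reaches A G v0 s V \<Longrightarrow> fst s \<in> V"
  unfolding reaches_def by auto

lemma step_not_Stop: "step A G s s' \<Longrightarrow> decide A G s \<noteq> Stop"
  by (auto elim: step.cases)

text \<open>Successors inside \<open>P\<close> are chosen once and for all and iterated from index
  \<open>k\<close> on. The run is cut at the first \<open>Stop\<close> from there, and is infinite
  if there is none; no index below \<open>k\<close> can stop, since a step is taken there.\<close>

lemma extend_to_run:
  assumes "v0 \<in> pverts G" and r0: "r 0 = (v0, \<lambda>_. 0)"
    and pre: "\<forall>i<k. step A G (r i) (r (Suc i))" and "P (r k)"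
    and closed: "\<And>s. P s \<Longrightarrow> decide A G s \<noteq> Stop \<Longrightarrow> \<exists>s'. step A G s s' \<and> P s'"
  obtains r' T where "is_run A G r' T" "\<And>i. i \<le> k \<Longrightarrow> r' i = r i" "enat k \<le> T"
    "\<And>i. k \<le> i \<Longrightarrow> enat i \<le> T \<Longrightarrow> P (r' i)"
proof -
  define nxt where "nxt s = (SOME s'. step A G s s' \<and> P s')" for s
  have nxt: "step A G s (nxt s) \<and> P (nxt s)" if "P s" "decide A G s \<noteq> Stop" for s
    unfolding nxt_def using closed[OF that] by (rule someI_ex)
  define r' where "r' i = (if i \<le> k then r i else (nxt ^^ (i - k)) (r k))" for i
  define S where "S = {i. k \<le> i \<and> decide A G (r' i) = Stop}"
  define T where "T = (if S = {} then \<infinity> else enat (LEAST i. i \<in> S))"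
  have r'_Suc: "r' (Suc i) = nxt (r' i)" if "k \<le> i" for i
    using that by (auto simp: r'_def Suc_diff_le)
  have not_Stop: "decide A G (r' i) \<noteq> Stop" if "k \<le> i" "enat i < T" for i
    using that not_less_Least[of i "\<lambda>i. i \<in> S"] by (auto simp: T_def S_def split: if_splits)
  have kT: "enat k \<le> T"
    using LeastI_ex[of "\<lambda>i. i \<in> S"] by (auto simp: T_def S_def)
  have P: "P (r' i)" if "k \<le> i" "enat i \<le> T" for i
    using that
  proof (induction i rule: dec_induct)
    case base
    then show ?case using \<open>P (r k)\<close> by (simp add: r'_def)
  next
    case (step i)
    then have "enat i < T" by (cases T) auto
    with step show ?case using nxt not_Stop by (simp add: r'_Suc)
  qed
  have "step A G (r' i) (r' (Suc i))" if "enat i < T" for i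
  proof (cases "i < k")
    case True
    then show ?thesis using pre by (simp add: r'_def)
  next
    case False
    then show ?thesis using that nxt P not_Stop by (simp add: r'_Suc)
  qed
  moreover have "decide A G (r' t) = Stop" if "T = enat t" for t
    using that LeastI_ex[of "\<lambda>i. i \<in> S"] by (auto simp: T_def S_def split: if_splits)
  moreover have "r' 0 = (v0, \<lambda>_. 0)" using r0 by (simp add: r'_def)
  ultimately have "is_run A G r' T" unfolding is_run_def using \<open>v0 \<in> pverts G\<close> by auto
  then show thesis using that kT P by (simp add: r'_def)
qed

text \<open>A configuration with a successor does not decide \<open>Stop\<close>, so an adversary
  that stays inside \<open>P\<close> keeps the agent moving forever, which exploration
  forbids.\<close>

lemma explores_no_trap:
  assumes "explores A G" "v0 \<in> pverts G" "reaches A G v0 s V" "P s"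
    and closed: "\<And>s. P s \<Longrightarrow> \<exists>s'. step A G s s' \<and> P s'"
  shows False
proof -
  from assms(3) obtain r k where r: "r 0 = (v0, \<lambda>_. 0)" "\<forall>i<k. step A G (r i) (r (Suc i))"
    "r k = s" unfolding reaches_def by blast
  obtain r' T where run: "is_run A G r' T" "enat k \<le> T"
    "\<And>i. k \<le> i \<Longrightarrow> enat i \<le> T \<Longrightarrow> P (r' i)"
    using extend_to_run[of v0 G r k A P] assms r by metis
  from \<open>explores A G\<close> run(1) obtain t where "T = enat t" "decide A G (r' t) = Stop"
    unfolding explores_def by blast
  then show False using run closed[of "r' t"] step_not_Stop by (metis enat_ord_simps(1) order_refl)
qed

lemma explores_Stop:
  assumes "explores A G" "v0 \<in> pverts G" "reaches A G v0 s V" "decide A G s = Stop"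
  shows "fst s = v0" "pverts G \<subseteq> V"
proof -
  from assms(3) obtain r k where r: "r 0 = (v0, \<lambda>_. 0)" "\<forall>i<k. step A G (r i) (r (Suc i))"
    "r k = s" "V = (\<lambda>i. fst (r i)) ` {..k}"
    unfolding reaches_def by blast
  then have "is_run A G r (enat k)" using assms unfolding is_run_def by auto
  then have "fst (r k) = fst (r 0) \<and> (\<forall>v \<in> pverts G. \<exists>i\<le>k. fst (r i) = v)"
    using \<open>explores A G\<close> unfolding explores_def by blast
  then show "fst s = v0" "pverts G \<subseteq> V" using r by auto
qed

section \<open>Colors occurring in a run\<close>

lemma color_assigned:
  assumes "r 0 = (v0, \<lambda>_. 0)" "\<forall>i<k. step A G (r i) (r (Suc i))" "snd (r k) u = c" "c \<noteq> 0"
  shows "\<exists>i d. i < k \<and> decide A G (r i) = Go c d"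
  using assms(2-)
proof (induction k)
  case 0
  then show ?case using assms(1) by simp
next
  case (Suc k)
  then have "step A G (r k) (r (Suc k))" by blast
  then show ?case
  proof cases
    case (1 v \<chi> e d w)
    show ?thesis
    proof (cases "snd (r k) u = c")
      case True
      then show ?thesis using Suc.IH Suc.prems by (meson less_Suc_eq)
    next
      case False
      then have "e = c" using 1 Suc.prems by (auto split: if_splits)
      then show ?thesis using 1 by auto
    qed
  qed
qed

lemma finite_neighbors:
  assumes "pair_graph G"
  shows "finite {w. (v, w) \<in> parcs G \<and> Q w}"
proof -
  interpret pair_graph G by fact
  have "{w. (v, w) \<in> parcs G \<and> Q w} \<subseteq> pverts G" using in_arcsD2 by blast
  then show ?thesis using pair_finite_verts finite_subset by blast
qed

lemma decide_Go:
  assumes "is_algorithm A" "pair_graph G" "decide A G (v, \<chi>) = Go c d"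
  shows "\<exists>w. (v, w) \<in> parcs G \<and> \<chi> w = d" and "\<chi> v \<noteq> 0 \<Longrightarrow> c = \<chi> v"
proof -
  let ?E = "\<lambda>c. card {w. (v, w) \<in> parcs G \<and> \<chi> w = c}"
  have "{c. ?E c \<noteq> 0} \<subseteq> \<chi> ` {w. (v, w) \<in> parcs G \<and> True}"
    by (auto simp: card_eq_0_iff)
  then have fin: "finite {c. ?E c \<noteq> 0}"
    by (rule finite_subset) (intro finite_imageI finite_neighbors[OF assms(2)])
  have "?E d > 0 \<and> (\<chi> v \<noteq> 0 \<longrightarrow> c = \<chi> v)"
    by (rule assms(1)[unfolded is_algorithm_def, rule_format, OF fin assms(3)[unfolded decide.simps]])
  then show "\<exists>w. (v, w) \<in> parcs G \<and> \<chi> w = d" and "\<chi> v \<noteq> 0 \<Longrightarrow> c = \<chi> v"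
    by (auto simp: card_gt_0_iff)
qed

text \<open>It suffices to see the colors in some reachable coloring: the initial coloring is zero,
  so each was assigned on the way, and the prefix extends to a complete run because a requested
  color always occurs at a neighbor.\<close>

lemma uses_at_least_reaches:
  assumes alg: "is_algorithm A" "pair_graph G" and "v0 \<in> pverts G" "reaches A G v0 (v, \<chi>) V"
    and C: "C \<subseteq> range \<chi> - {0}" "finite C"
  shows "uses_at_least A (card C) G"
proof -
  from assms(4) obtain r k where r: "r 0 = (v0, \<lambda>_. 0)" "\<forall>i<k. step A G (r i) (r (Suc i))"
    "r k = (v, \<chi>)" unfolding reaches_def by blast
  have "\<exists>s'. step A G s s' \<and> True" if "decide A G s \<noteq> Stop" for s
  proof (cases s)
    case (Pair v \<chi>)
    obtain c d where "decide A G (v, \<chi>) = Go c d" using \<open>_ \<noteq> Stop\<close> Pair by (cases "decide A G s") auto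
    moreover from decide_Go(1)[OF alg this] obtain w where "(v, w) \<in> parcs G" "\<chi> w = d" by blast
    ultimately show ?thesis using step.intros Pair by blast
  qed
  then obtain r' T where run: "is_run A G r' T" "\<And>i. i \<le> k \<Longrightarrow> r' i = r i" "enat k \<le> T"
    using extend_to_run[of v0 G r k A "\<lambda>_. True"] assms(3) r by metis
  have "C \<subseteq> colors_used A G r' T"
  proof
    fix c assume "c \<in> C"
    then obtain u where "\<chi> u = c" "c \<noteq> 0" using C by auto
    then obtain i d where "i < k" "decide A G (r i) = Go c d"
      using color_assigned[OF r(1,2), of u c] r(3) by auto
    moreover have "enat i < T" using \<open>i < k\<close> run(3) by (metis enat_ord_simps(2) less_le_trans)
    ultimately show "c \<in> colors_used A G r' T"
      unfolding colors_used_def using run(2)[of i] \<open>c \<noteq> 0\<close> by auto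
  qed
  then show ?thesis unfolding uses_at_least_def using run(1) C(2) by blast
qed

section \<open>Cliques with leaves\<close>

text \<open>
  The clique vertices are the numbers below \<open>q\<close>, and a leaf \<open>w \<ge> q\<close> is attached to \<open>w mod q\<close>.
  Every clique vertex has degree \<open>q + m - 1\<close>.
\<close>

definition leafy_clique :: "nat \<Rightarrow> nat \<Rightarrow> nat pair_pre_digraph" where
  "leafy_clique q m = \<lparr>pverts = {..<q * Suc m},
     parcs = {(u, w). u < q * Suc m \<and> w < q * Suc m \<and> u \<noteq> w \<and>
       (u < q \<and> w < q \<or> u = w mod q \<or> w = u mod q)}\<rparr>"

definition leaves :: "nat \<Rightarrow> nat \<Rightarrow> nat \<Rightarrow> nat set" where
  "leaves q m u = {w. q \<le> w \<and> w < q * Suc m \<and> w mod q = u}"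

lemma pverts_leafy_clique [simp]: "pverts (leafy_clique q m) = {..<q * Suc m}"
  by (simp add: leafy_clique_def)

lemma clique_vertex_no_leaf: "w < q \<Longrightarrow> w \<notin> leaves q m u"
  by (auto simp: leaves_def)

lemma finite_leaves [simp]: "finite (leaves q m u)"
  by (rule finite_subset[of _ "{..<q * Suc m}"]) (auto simp: leaves_def)

lemma card_leaves:
  assumes "u < q"
  shows "card (leaves q m u) = m"
proof -
  \<comment> \<open>The leaves of \<open>u\<close> are u + q, u + 2q, ..., u + mq.\<close>
  have "leaves q m u = (\<lambda>t. u + q * Suc t) ` {..<m}"
  proof (intro equalityI subsetI)
    fix w assume w: "w \<in> leaves q m u"
    then obtain t where t: "w div q = Suc t"
      using assms by (auto simp: leaves_def) (metis div_greater_zero_iff gr0_implies_Suc less_nat_zero_code linorder_neqE_nat)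
    have "w = u + q * Suc t" using w t div_mult_mod_eq[of w q] by (auto simp: leaves_def algebra_simps)
    moreover have "Suc t < Suc m"
      using w t less_mult_imp_div_less[of w "Suc m" q] by (auto simp: leaves_def mult.commute)
    ultimately show "w \<in> (\<lambda>t. u + q * Suc t) ` {..<m}" by auto
  next
    fix w assume "w \<in> (\<lambda>t. u + q * Suc t) ` {..<m}"
    then obtain t where "t < m" "w = u + q * Suc t" by auto
    moreover have "u + q * Suc t < q * Suc (Suc t)" using assms by simp
    moreover have "q * Suc (Suc t) \<le> q * Suc m" using \<open>t < m\<close> by (intro mult_le_mono2) simp
    moreover have "(u + q * Suc t) mod q = u" using assms by (metis mod_less mod_mult_self2)
    ultimately show "w \<in> leaves q m u" unfolding leaves_def by auto
  qed
  moreover have "inj_on (\<lambda>t. u + q * Suc t) {..<m}" using assms by (auto simp: inj_on_def)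
  ultimately show ?thesis by (simp add: card_image)
qed

lemma le_mult_Suc: "u < q \<Longrightarrow> u < q * Suc m"
  by simp

lemma arc_clique_iff:
  assumes "u < q"
  shows "(u, w) \<in> parcs (leafy_clique q m) \<longleftrightarrow> w < q \<and> w \<noteq> u \<or> w \<in> leaves q m u"
  using assms by (auto simp: leafy_clique_def leaves_def)

lemma arc_leaf_iff:
  assumes "q \<le> u" "u < q * Suc m"
  shows "(u, w) \<in> parcs (leafy_clique q m) \<longleftrightarrow> w = u mod q"
proof -
  have "0 < q" using assms by (cases q) auto
  then have "u mod q < q" "w mod q < q" by simp_all
  then show ?thesis using assms by (auto simp: leafy_clique_def)
qed

lemma pair_graph_leafy_clique: "pair_graph (leafy_clique q m)"
proof
  show "finite (parcs (leafy_clique q m))"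
    by (rule finite_subset[of _ "{..<q * Suc m} \<times> {..<q * Suc m}"]) (auto simp: leafy_clique_def)
qed (auto simp: leafy_clique_def symmetric_def sym_def)

lemma connected_graph_leafy_clique:
  assumes "0 < q"
  shows "connected_graph (leafy_clique q m)"
proof -
  let ?G = "leafy_clique q m"
  interpret pair_graph ?G by (rule pair_graph_leafy_clique)
  have to0: "u \<rightarrow>\<^sup>*\<^bsub>?G\<^esub> 0" if "u < q" for u
  proof (cases "u = 0")
    case False
    then show ?thesis using that assms by (intro reachable_adjI) (simp add: arc_clique_iff)
  qed (use assms in \<open>auto intro!: reachable_refl\<close>)
  have to0': "u \<rightarrow>\<^sup>*\<^bsub>?G\<^esub> 0" if "u < q * Suc m" for u
  proof (cases "u < q")
    case False
    then have "(u, u mod q) \<in> parcs ?G" using that by (simp add: arc_leaf_iff)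
    then show ?thesis using to0[of "u mod q"] assms by (auto intro: adj_reachable_trans)
  qed (rule to0)
  have "u \<rightarrow>\<^sup>*\<^bsub>?G\<^esub> v" if "u < q * Suc m" "v < q * Suc m" for u v
    using that to0' symmetric_reachable[OF pair_sym_arcs] reachable_trans by blast
  then have "connected (with_proj ?G)"
    using assms by (intro connectedI) (auto intro: reachable_mk_symmetricI)
  then show ?thesis unfolding connected_graph_def by (simp add: pair_graph_leafy_clique)
qed

lemma card_neighbors_clique:
  assumes "u < q"
  shows "card {w. (u, w) \<in> parcs (leafy_clique q m) \<and> Q w} =
    card {w. w < q \<and> w \<noteq> u \<and> Q w} + card {w \<in> leaves q m u. Q w}"
proof -
  have "{w. (u, w) \<in> parcs (leafy_clique q m) \<and> Q w} =
      {w. w < q \<and> w \<noteq> u \<and> Q w} \<union> {w \<in> leaves q m u. Q w}"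
    using assms by (auto simp: arc_clique_iff)
  moreover have "{w. w < q \<and> w \<noteq> u \<and> Q w} \<inter> {w \<in> leaves q m u. Q w} = {}"
    by (auto simp: leaves_def)
  ultimately show ?thesis by (simp add: card_Un_disjoint)
qed

section \<open>Two clique vertices of the same color\<close>

text \<open>
  The adversary keeps the agent away from one of the two equally colored vertices \<open>a\<close>, \<open>b\<close> (called
  \<open>y\<close> below) and lets it use only the other one (\<open>x\<close>), until the agent asks for color \<open>j\<close> at \<open>x\<close>;
  then the roles are swapped. The decision at \<open>x\<close> depends only on the number of visited leaves
  of \<open>x\<close>. Hence if all leaves have been visited, then the decision to swap, by which the agent last
  left \<open>y\<close>, contradicts the decision by which it last left \<open>x\<close>.
\<close>

lemma repeated_clique_color:
  fixes q m :: nat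
  defines "G \<equiv> leafy_clique q m"
  assumes alg: "is_algorithm A" and expl: "explores A G" and "0 < m"
    and ab: "a < q" "b < q" "a \<noteq> b"
    and \<kappa>: "\<And>u. u < q \<Longrightarrow> \<kappa> u \<noteq> 0" "\<kappa> a = j" "\<kappa> b = j"
    and start: "reaches A G 0 (v, \<chi>) V" "\<And>u. u < q \<Longrightarrow> \<chi> u = \<kappa> u"
      "v < q * Suc m" "v mod q \<noteq> b"
      "\<And>w. q \<le> w \<Longrightarrow> w < q * Suc m \<Longrightarrow> \<chi> w = 0 \<and> (w \<noteq> v \<longrightarrow> w \<notin> V)"
      "V \<inter> leaves q m b = {}" "v mod q \<noteq> a \<Longrightarrow> V \<inter> leaves q m a = {}"
  shows False
proof -
  have "0 < q" using ab by simp
  have G: "pair_graph G" unfolding G_def by (rule pair_graph_leafy_clique)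
  have "0 \<in> pverts G" using \<open>0 < q\<close> by (simp add: G_def)
  \<comment> \<open>The color assigned on leaving an uncolored leaf whose only neighbor has color
    \<open>j\<close>. It may be 0; the value for \<open>Stop\<close> is a mere default.\<close>
  define l where "l = (case A 0 (\<lambda>c. if c = j then 1 else 0) of Go c d \<Rightarrow> c | Stop \<Rightarrow> 0)"
  define L where "L = leaves q m"
  \<comment> \<open>The environment at \<open>a\<close> or \<open>b\<close> when \<open>s\<close> of
    its leaves are visited and colored \<open>l\<close>. The vertex does not count itself, hence the
    correction at \<open>j\<close>. The last two terms are added, not split by cases, so that
    \<open>l = 0\<close> is covered.\<close>
  define E where "E s c = (card {w. w < q \<and> \<kappa> w = c} - (if c = j then 1 else 0)) +
    ((if c = l then s else 0) + (if c = 0 then m - s else 0))" for s c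
  define g where "g s = A j (E s)" for s
  \<comment> \<open>Here \<open>x\<close> is the vertex in use and \<open>y\<close> the avoided one.
    The current position is exempt from the leaf coloring, since a leaf just entered is visited but
    not yet colored. The last two clauses record the latest departures: from \<open>y\<close> by a
    request for \<open>j\<close>, from \<open>x\<close> by another request, unless no leaf of that
    vertex has been visited. The visited leaf counts cannot change while the agent is away.\<close>
  define inv where "inv v \<chi> V x y \<longleftrightarrow> reaches A G 0 (v, \<chi>) V \<and> {x, y} = {a, b} \<and>
    (\<forall>u<q. \<chi> u = \<kappa> u) \<and> v < q * Suc m \<and> v mod q \<noteq> y \<and>
    (\<forall>u\<in>{a, b}. \<forall>w\<in>L u. \<chi> w \<in> {0, l} \<and> (w \<noteq> v \<longrightarrow> \<chi> w = (if w \<in> V then l else 0))) \<and>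
    (V \<inter> L y = {} \<or> (\<exists>c. g (card (V \<inter> L y)) = Go c j)) \<and>
    (v mod q \<noteq> x \<longrightarrow> V \<inter> L x = {} \<or> (\<nexists>c. g (card (V \<inter> L x)) = Go c j))" for v \<chi> V x y
  have decide_main: "decide A G (x, \<chi>) = g (card (V \<inter> L x))" if "inv x \<chi> V x y" for \<chi> V x y
  proof -
    have "x \<in> {a, b}" "\<forall>u<q. \<chi> u = \<kappa> u" using that unfolding inv_def by blast+
    then have x: "x < q" "x \<in> {a, b}" "\<kappa> x = j" "\<forall>u<q. \<chi> u = \<kappa> u"
      using ab(1,2) \<kappa>(2,3) by blast+
    have "card {w. w < q \<and> w \<noteq> x \<and> \<chi> w = c} =
        card {w. w < q \<and> \<kappa> w = c} - (if c = j then 1 else 0)" for c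
    proof -
      have "{w. w < q \<and> w \<noteq> x \<and> \<chi> w = c} = {w. w < q \<and> \<kappa> w = c} - {x}" using x by auto
      then show ?thesis using x by (auto simp: card_Diff_singleton_if)
    qed
    moreover have "card {w \<in> L x. \<chi> w = c} =
        (if c = l then card (V \<inter> L x) else 0) + (if c = 0 then m - card (V \<inter> L x) else 0)" for c
    proof -
      have "\<forall>w\<in>L x. w \<noteq> x" using x clique_vertex_no_leaf by (auto simp: L_def)
      then have "\<forall>w\<in>L x. \<chi> w = (if w \<in> V then l else 0)" using that x(2) by (auto simp: inv_def)
      then have "{w \<in> L x. \<chi> w = c} =
          (if c = l then V \<inter> L x else {}) \<union> (if c = 0 then L x - V else {})" by (auto split: if_splits)
      moreover have "card (L x - V) = m - card (V \<inter> L x)"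
        using x(1) by (simp add: card_Diff_subset_Int L_def card_leaves Int_commute)
      moreover have "card ((if c = l then V \<inter> L x else {}) \<union> (if c = 0 then L x - V else {})) =
         card (if c = l then V \<inter> L x else {}) + card (if c = 0 then L x - V else {})"
        by (rule card_Un_disjoint) (auto simp: L_def)
      ultimately show ?thesis by simp
    qed
    ultimately show ?thesis
      using x(1) unfolding g_def E_def decide.simps G_def
      by (subst card_neighbors_clique) (simp_all add: x L_def)
  qed
  have not_Stop: "decide A G (v, \<chi>) \<noteq> Stop" if inv: "inv v \<chi> V x y" for v \<chi> V x y
  proof
    assume stop: "decide A G (v, \<chi>) = Stop"
    have "reaches A G 0 (v, \<chi>) V" using inv by (simp add: inv_def)
    from explores_Stop[OF expl \<open>0 \<in> pverts G\<close> this stop]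
    have "v = 0" "pverts G \<subseteq> V" by auto
    have xy: "x < q" "y < q" using inv ab by (auto simp: inv_def doubleton_eq_iff)
    have "L u \<subseteq> V" for u
      using \<open>pverts G \<subseteq> V\<close> by (auto simp: L_def leaves_def G_def)
    then have all: "V \<inter> L x = L x" "V \<inter> L y = L y" by auto
    have card: "card (L x) = m" "card (L y) = m" using xy by (simp_all add: L_def card_leaves)
    then have nonempty: "L x \<noteq> {}" "L y \<noteq> {}" using \<open>0 < m\<close> by auto
    \<comment> \<open>With all leaves visited both counts are \<open>m\<close>, so the clause for
      \<open>y\<close> makes \<open>g m\<close> a request for \<open>j\<close>. At \<open>x\<close>
      this decision is not \<open>Stop\<close>. Elsewhere the agent is at the clique vertex 0, hence
      away from \<open>x\<close>, and the clause for \<open>x\<close> denies that \<open>g m\<close>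
      requests \<open>j\<close>.\<close>
    then obtain c where c: "g m = Go c j" using inv all card by (auto simp: inv_def)
    show False
    proof (cases "v = x")
      case True
      then show False using decide_main inv stop c all card by simp
    next
      case False
      then show False using inv c all card nonempty \<open>v = 0\<close> by (auto simp: inv_def)
    qed
  qed
  have next_step: "\<exists>w \<chi>' V' x' y'. step A G (v, \<chi>) (w, \<chi>') \<and> inv w \<chi>' V' x' y'"
    if inv: "inv v \<chi> V x y" for v \<chi> V x y
  proof -
    obtain c d where cd: "decide A G (v, \<chi>) = Go c d"
      using not_Stop[OF inv] by (cases "decide A G (v, \<chi>)") auto
    obtain w where w: "(v, w) \<in> parcs G" "\<chi> w = d"
      using decide_Go(1)[OF alg G cd] by blast
    have v: "v < q * Suc m" "v mod q \<noteq> y" and R: "reaches A G 0 (v, \<chi>) V"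
      and xy: "{x, y} = {a, b}" and clique: "\<forall>u<q. \<chi> u = \<kappa> u"
      and leaf: "\<forall>u\<in>{a, b}. \<forall>w\<in>L u. \<chi> w \<in> {0, l} \<and> (w \<noteq> v \<longrightarrow> \<chi> w = (if w \<in> V then l else 0))"
      and swapped: "V \<inter> L y = {} \<or> (\<exists>c. g (card (V \<inter> L y)) = Go c j)"
      and away: "v mod q \<noteq> x \<longrightarrow> V \<inter> L x = {} \<or> (\<nexists>c. g (card (V \<inter> L x)) = Go c j)"
      using inv by (auto simp: inv_def)
    have xy': "x < q" "y < q" "x \<noteq> y" "\<kappa> x = j" "\<kappa> y = j"
      using xy ab \<kappa> by (auto simp: doubleton_eq_iff)
    show ?thesis
    proof (cases "v < q")
      case False
      let ?u = "v mod q" and ?\<chi> = "\<chi>(v := c)"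
      have u: "?u < q" using \<open>0 < q\<close> by simp
      have w_eq: "w = ?u" using w v False by (simp add: arc_leaf_iff G_def)
      \<comment> \<open>An uncolored leaf of \<open>a\<close> or \<open>b\<close> sees one neighbor
        of color \<open>j\<close>, which is the environment defining \<open>l\<close>; a colored one
        already has color \<open>l\<close> and keeps it.\<close>
      have "c = l" if "v \<in> L u" "u \<in> {a, b}" for u
      proof (cases "\<chi> v = 0")
        case True
        have "?u = u" using that by (simp add: L_def leaves_def)
        then have "\<chi> ?u = j" using that clique u \<kappa> by auto
        then have "{w. (v, w) \<in> parcs G \<and> \<chi> w = e} = (if e = j then {?u} else {})" for e
          using v False by (auto simp: arc_leaf_iff G_def)
        then have "(\<lambda>e. card {w. (v, w) \<in> parcs G \<and> \<chi> w = e}) = (\<lambda>e. if e = j then 1 else 0)"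
          by auto
        then have "A 0 (\<lambda>e. if e = j then 1 else 0) = Go c d" using cd True by simp
        then show ?thesis by (simp add: l_def)
      next
        case False
        then show ?thesis using decide_Go(2)[OF alg G cd] leaf that by auto
      qed
      moreover have "v \<in> V" using position_visited[OF R] by simp
      ultimately have leaf': "\<forall>u\<in>{a, b}. \<forall>w\<in>L u. ?\<chi> w = (if w \<in> V then l else 0)"
        using leaf by auto
      have step: "step A G (v, \<chi>) (?u, ?\<chi>)" using step.intros[OF cd w] w_eq by simp
      have ins: "insert ?u V \<inter> L z = V \<inter> L z" for z
        using u clique_vertex_no_leaf by (auto simp: L_def)
      have "inv ?u ?\<chi> (insert ?u V) x y"
        unfolding inv_def ins
      proof (intro conjI)
        show "reaches A G 0 (?u, ?\<chi>) (insert ?u V)" using reaches_step[OF R step] by simp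
        show "\<forall>ua\<in>{a, b}. \<forall>w\<in>L ua. ?\<chi> w \<in> {0, l} \<and>
            (w \<noteq> ?u \<longrightarrow> ?\<chi> w = (if w \<in> insert ?u V then l else 0))"
          using leaf' by (auto simp del: fun_upd_apply)
        show "\<forall>u<q. ?\<chi> u = \<kappa> u" using clique False by simp
      qed (use u v xy swapped away in \<open>simp_all add: le_mult_Suc\<close>)
      then show ?thesis using step by blast
    next
      case True
      have v_mod: "v mod q = v" using True by simp
      have "c = \<chi> v" using decide_Go(2)[OF alg G cd] clique True \<kappa>(1) by simp
      then have stay: "\<chi>(v := c) = \<chi>" by simp
      \<comment> \<open>Clique vertices are all colored already, so a move from one of them changes
        only the position and the visited set.\<close>
      have inv_move: "step A G (v, \<chi>) (z, \<chi>) \<and> inv z \<chi> (insert z V) x' y'"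
        if z: "(v, z) \<in> parcs G" "\<chi> z = d" "{x', y'} = {a, b}" "z mod q \<noteq> y'"
          "insert z V \<inter> L y' = {} \<or> (\<exists>c. g (card (insert z V \<inter> L y')) = Go c j)"
          "z mod q \<noteq> x' \<longrightarrow>
            insert z V \<inter> L x' = {} \<or> (\<nexists>c. g (card (insert z V \<inter> L x')) = Go c j)" for z x' y'
      proof -
        have step: "step A G (v, \<chi>) (z, \<chi>)" using step.intros[OF cd z(1,2)] stay by simp
        have "\<forall>u\<in>{a, b}. \<forall>w\<in>L u. \<chi> w \<in> {0, l} \<and>
            (w \<noteq> z \<longrightarrow> \<chi> w = (if w \<in> insert z V then l else 0))"
          using leaf clique_vertex_no_leaf[OF True] by (auto simp: L_def)
        moreover have "z < q * Suc m" using z(1) by (simp add: G_def leafy_clique_def)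
        ultimately show ?thesis
          using z clique reaches_step[OF R step] step unfolding inv_def by simp
      qed
      have ins: "insert z V \<inter> L u = V \<inter> L u" if "z < q" for z u
        using that clique_vertex_no_leaf by (auto simp: L_def)
      have w_cases: "w < q \<and> w \<noteq> v \<or> w \<in> L v" using w(1) True by (simp add: arc_clique_iff G_def L_def)
      have w_ins: "insert w V \<inter> L u = V \<inter> L u" if "u \<noteq> v" for u
        using w_cases that ins by (auto simp: L_def leaves_def)
      \<comment> \<open>The strategy of the adversary: a request for \<open>j\<close> at
        \<open>x\<close> is answered by \<open>y\<close>, which swaps the roles; a request for
        \<open>j\<close> elsewhere is answered by \<open>x\<close>; any other request is answered
        arbitrarily, and cannot lead to \<open>y\<close>, which has color \<open>j\<close>.\<close>
      consider "v = x" "d = j" | "v = x" "d \<noteq> j" | "v \<noteq> x" "d = j" | "v \<noteq> x" "d \<noteq> j" by blast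
      then show ?thesis
      proof cases
        case 1
        have "step A G (v, \<chi>) (y, \<chi>) \<and> inv y \<chi> (insert y V) y x"
        proof (rule inv_move)
          show "(v, y) \<in> parcs G" using 1 xy' by (simp add: G_def arc_clique_iff)
          show "insert y V \<inter> L x = {} \<or> (\<exists>c. g (card (insert y V \<inter> L x)) = Go c j)"
            using decide_main inv 1 cd ins xy' by auto
        qed (use 1 xy xy' clique in auto)
        then show ?thesis by blast
      next
        case 2
        have g: "g (card (V \<inter> L x)) = Go c d" using decide_main inv 2 cd by auto
        have "step A G (v, \<chi>) (w, \<chi>) \<and> inv w \<chi> (insert w V) x y"
        proof (rule inv_move)
          show "w mod q \<noteq> y" using w_cases 2 w xy' clique by (auto simp: L_def leaves_def)
          show "insert w V \<inter> L y = {} \<or> (\<exists>c. g (card (insert w V \<inter> L y)) = Go c j)"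
            using swapped w_ins[of y] 2 xy' by simp
          show "w mod q \<noteq> x \<longrightarrow>
              insert w V \<inter> L x = {} \<or> (\<nexists>c. g (card (insert w V \<inter> L x)) = Go c j)"
          proof
            assume "w mod q \<noteq> x"
            then have "w < q" using w_cases 2 by (auto simp: L_def leaves_def)
            then show "insert w V \<inter> L x = {} \<or> (\<nexists>c. g (card (insert w V \<inter> L x)) = Go c j)"
              using g ins 2 by simp
          qed
        qed (use w xy in auto)
        then show ?thesis by blast
      next
        case 3
        have "step A G (v, \<chi>) (x, \<chi>) \<and> inv x \<chi> (insert x V) x y"
        proof (rule inv_move)
          show "(v, x) \<in> parcs G" using 3 xy' True by (simp add: G_def arc_clique_iff)
        qed (use 3 xy xy' clique swapped ins in auto)
        then show ?thesis by blast
      next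
        case 4
        have "step A G (v, \<chi>) (w, \<chi>) \<and> inv w \<chi> (insert w V) x y"
        proof (rule inv_move)
          show "w mod q \<noteq> y" using w_cases 4 w v v_mod xy' clique by (auto simp: L_def leaves_def)
          show "insert w V \<inter> L y = {} \<or> (\<exists>c. g (card (insert w V \<inter> L y)) = Go c j)"
            using swapped w_ins[of y] v v_mod by simp
          show "w mod q \<noteq> x \<longrightarrow>
              insert w V \<inter> L x = {} \<or> (\<nexists>c. g (card (insert w V \<inter> L x)) = Go c j)"
            using away w_ins[of x] 4 v_mod by simp
        qed (use w xy in auto)
        then show ?thesis by blast
      qed
    qed
  qed
  have "inv v \<chi> V a b"
    unfolding inv_def L_def
  proof (intro conjI)
    show "\<forall>u\<in>{a, b}. \<forall>w\<in>leaves q m u. \<chi> w \<in> {0, l} \<and>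
        (w \<noteq> v \<longrightarrow> \<chi> w = (if w \<in> V then l else 0))"
      using start(5) by (auto simp: leaves_def)
  qed (use start in auto)
  then show False
    using explores_no_trap[OF expl \<open>0 \<in> pverts G\<close> start(1), of "\<lambda>s. \<exists>V x y. inv (fst s) (snd s) V x y"]
      next_step by fastforce
qed

section \<open>Replaying the exploration of the complete graph\<close>

text \<open>
  The environment of a clique vertex of color \<open>p\<close> in a \<open>leafy_clique\<close> with \<open>q + m = n\<close>, when no
  leaf is colored and the nonzero colors of the clique vertices are pairwise distinct and form the
  set \<open>C\<close>. It does not depend on \<open>q\<close>.
\<close>

definition clique_env :: "nat \<Rightarrow> nat set \<Rightarrow> nat \<Rightarrow> nat \<Rightarrow> nat" where
  "clique_env n C p c =
     (if c = 0 then n - card C - (if p = 0 then 1 else 0) else if c \<in> C \<and> c \<noteq> p then 1 else 0)"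

text \<open>A run abstracted to the set of nonzero colors used and the color of the current vertex.
  No graph is mentioned, so one derivation can be replayed for different clique sizes. Removing 0
  covers vertices left uncolored.\<close>

inductive clique_state :: "algorithm \<Rightarrow> nat \<Rightarrow> nat set \<Rightarrow> nat \<Rightarrow> bool" for A n where
  start: "clique_state A n {} 0"
| move: "clique_state A n C p \<Longrightarrow> A p (clique_env n C p) = Go c d \<Longrightarrow> (p = 0 \<Longrightarrow> c \<notin> C) \<Longrightarrow>
    clique_state A n (insert c C - {0}) d"

definition realizes :: "nat \<Rightarrow> nat set \<Rightarrow> nat \<Rightarrow> nat \<times> (nat \<Rightarrow> nat) \<Rightarrow> bool" where
  "realizes q C p s \<longleftrightarrow> (case s of (v, \<chi>) \<Rightarrow>
     v < q \<and> \<chi> v = p \<and> bij_betw \<chi> {u. u < q \<and> \<chi> u \<noteq> 0} C \<and> (\<forall>w\<ge>q. \<chi> w = 0))"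

text \<open>Uncolored clique vertices and leaves look alike to the agent, and a vertex has q - 1
  clique neighbors and \<open>m\<close> leaves, so only the sum q + m matters.\<close>

lemma clique_env_realizes:
  assumes "realizes q C p (v, \<chi>)" and "q + m = n"
  shows "decide A (leafy_clique q m) (v, \<chi>) = A p (clique_env n C p)"
proof -
  have v: "v < q" "\<chi> v = p" and bij: "bij_betw \<chi> {u. u < q \<and> \<chi> u \<noteq> 0} C"
    and leaf: "\<forall>w\<ge>q. \<chi> w = 0"
    using assms(1) by (auto simp: realizes_def)
  have "card {w. (v, w) \<in> parcs (leafy_clique q m) \<and> \<chi> w = c} = clique_env n C p c" for c
  proof -
    have eq: "card {w. (v, w) \<in> parcs (leafy_clique q m) \<and> \<chi> w = c} =
        card {w. w < q \<and> w \<noteq> v \<and> \<chi> w = c} + card {w \<in> leaves q m v. \<chi> w = c}"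
      using v(1) by (rule card_neighbors_clique)
    have leaves0: "{w \<in> leaves q m v. \<chi> w = c} = (if c = 0 then leaves q m v else {})"
      using leaf by (auto simp: leaves_def)
    show ?thesis
    proof (cases "c = 0")
      case True
      have "{w. w < q \<and> w \<noteq> v \<and> \<chi> w = 0} = {..<q} - {u. u < q \<and> \<chi> u \<noteq> 0} - (if p = 0 then {v} else {})"
        using v by auto
      moreover have "card ({..<q} - {u. u < q \<and> \<chi> u \<noteq> 0}) = q - card C"
        by (subst card_Diff_subset) (auto simp: bij_betw_same_card[OF bij, symmetric])
      \<comment> \<open>This and the next bound ensure that no subtraction truncates before the
        \<open>m\<close> leaves are added.\<close>
      moreover have "card ({..<q} - {u. u < q \<and> \<chi> u \<noteq> 0}) > 0" if "p = 0"
        using that v by (auto simp: card_gt_0_iff)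
      moreover have "card C \<le> q"
        using card_mono[of "{..<q}" "{u. u < q \<and> \<chi> u \<noteq> 0}"] bij_betw_same_card[OF bij] by auto
      ultimately show ?thesis
        using True v \<open>q + m = n\<close> eq leaves0
        by (auto simp: clique_env_def card_leaves card_Diff_singleton_if)
    next
      case False
      have "card {w. w < q \<and> w \<noteq> v \<and> \<chi> w = c} = (if c \<in> C \<and> c \<noteq> p then 1 else 0)"
      proof (cases "c \<in> C \<and> c \<noteq> p")
        case True
        then obtain u where u: "u < q" "\<chi> u = c" using bij by (auto simp: bij_betw_def)
        have "{w. w < q \<and> w \<noteq> v \<and> \<chi> w = c} = {u}"
          using u True v False bij by (auto simp: bij_betw_def inj_on_def)
        then show ?thesis using True by simp
      next
        case F: False
        have "w = v" if "w < q" "\<chi> w = c" for w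
        proof -
          have "c \<in> C" using bij that False by (auto simp: bij_betw_def)
          then have "\<chi> v = \<chi> w" "\<chi> w \<noteq> 0" using F that v False by auto
          then show ?thesis using bij that v by (auto simp: bij_betw_def inj_on_def)
        qed
        then have "{w. w < q \<and> w \<noteq> v \<and> \<chi> w = c} = {}" by auto
        then have "card {w. w < q \<and> w \<noteq> v \<and> \<chi> w = c} = 0" by (simp only: card.empty)
        then show ?thesis using F by auto
      qed
      then show ?thesis using eq leaves0 False by (simp add: clique_env_def)
    qed
  qed
  then show ?thesis using v(2) by simp
qed

text \<open>The adversary keeps the agent inside the clique. A nonzero color is never on a leaf; for
  color 0 the bound \<open>free\<close> leaves an uncolored clique vertex other than the current
  one.\<close>

lemma realizes_step:
  assumes alg: "is_algorithm A" and real: "realizes q C p (v, \<chi>)" and "q + m = n"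
    and cd: "A p (clique_env n C p) = Go c d" and fresh: "p = 0 \<Longrightarrow> c \<notin> C"
    and free: "d = 0 \<Longrightarrow> card C + (if p = 0 then 1 else 0) < q"
  obtains w where "w < q" "step A (leafy_clique q m) (v, \<chi>) (w, \<chi>(v := c))"
    "realizes q (insert c C - {0}) d (w, \<chi>(v := c))"
proof -
  let ?\<chi> = "\<chi>(v := c)" and ?G = "leafy_clique q m" and ?S = "{u. u < q \<and> \<chi> u \<noteq> 0}"
  have v: "v < q" "\<chi> v = p" and bij: "bij_betw \<chi> ?S C"
    and leaf: "\<forall>w\<ge>q. \<chi> w = 0"
    using real by (auto simp: realizes_def)
  have dec: "decide A ?G (v, \<chi>) = Go c d"
    using clique_env_realizes[OF real \<open>q + m = n\<close>] cd by (rule trans)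
  note Go = decide_Go[OF alg pair_graph_leafy_clique dec]
  have C0: "0 \<notin> C" using bij by (auto simp: bij_betw_def)
  have "\<exists>w<q. w \<noteq> v \<and> \<chi> w = d"
  proof (cases "d = 0")
    case False
    obtain w where "(v, w) \<in> parcs ?G" "\<chi> w = d" using Go(1) by blast
    then show ?thesis using False leaf v(1) by (auto simp: arc_clique_iff leaves_def)
  next
    case True
    have "card (insert v ?S) = card C + (if p = 0 then 1 else 0)"
      using v bij_betw_same_card[OF bij] by (auto simp: card_insert_if)
    then have "card (insert v ?S) < card {..<q}" using free True by simp
    then have "\<not> {..<q} \<subseteq> insert v ?S" using card_mono[of "insert v ?S" "{..<q}"] by auto
    then show ?thesis using True by auto
  qed
  then obtain w where w: "w < q" "w \<noteq> v" "\<chi> w = d" by blast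
  have "bij_betw ?\<chi> {u. u < q \<and> ?\<chi> u \<noteq> 0} (insert c C - {0})"
  proof (cases "p = 0 \<and> c \<noteq> 0")
    case True
    have "{u. u < q \<and> ?\<chi> u \<noteq> 0} = insert v ?S" using True v by auto
    moreover have "bij_betw ?\<chi> (insert v ?S) (insert c C)"
    proof -
      have "v \<notin> ?S" using True v by auto
      moreover from this have "bij_betw ?\<chi> ?S C"
        using bij by (subst bij_betw_cong[of _ _ \<chi>]) auto
      ultimately show ?thesis using fresh True by (auto simp: bij_betw_def)
    qed
    ultimately show ?thesis using True C0 by simp
  next
    case False
    then have c: "c = p" using Go(2) v(2) by (cases "p = 0") simp_all
    then have "?\<chi> = \<chi>" using v by auto
    moreover have "insert c C - {0} = C"
    proof (cases "p = 0")
      case False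
      then have "p \<in> C" using v bij by (auto simp: bij_betw_def)
      then show ?thesis using c C0 by auto
    qed (use c C0 in auto)
    ultimately show ?thesis using bij by simp
  qed
  then have "realizes q (insert c C - {0}) d (w, ?\<chi>)"
    using w leaf v by (auto simp: realizes_def)
  moreover have "step A ?G (v, \<chi>) (w, ?\<chi>)"
    using step.intros[OF dec _ w(3)] w v by (simp add: arc_clique_iff)
  ultimately show thesis using that w(1) by blast
qed

lemma clique_state_set:
  assumes "clique_state A n C p"
  shows "finite C" "0 \<notin> C"
  using assms by (induction) auto

lemma clique_state_mono:
  assumes "clique_state A n C p"
  shows "card C \<le> card (insert c C - {0})"
  using clique_state_set[OF assms] by (intro card_mono) auto

text \<open>While fewer than \<open>q\<close> colors are in use the clique has an uncolored vertex,
  so the replay never needs a leaf.\<close>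

lemma clique_state_realized:
  assumes alg: "is_algorithm A" and "clique_state A n C p" "card C < q" "q + m = n"
  shows "\<exists>s V. reaches A (leafy_clique q m) 0 s V \<and> V \<subseteq> {..<q} \<and> realizes q C p s"
  using assms(2,3)
proof induction
  case start
  then show ?case
    using reaches_start[of A "leafy_clique q m" 0]
    by (intro exI[of _ "(0, \<lambda>_. 0)"] exI[of _ "{0}"]) (auto simp: realizes_def bij_betw_def)
next
  case (move C p c d)
  note C = clique_state_set[OF move.hyps(1)]
  have "card C < q" using move.prems clique_state_mono[OF move.hyps(1), of c] by simp
  then obtain v \<chi> V where IH: "reaches A (leafy_clique q m) 0 (v, \<chi>) V" "V \<subseteq> {..<q}"
    "realizes q C p (v, \<chi>)" using move.IH by auto
  show ?case
  \<comment> \<open>Such a move leaves the abstract state unchanged, and the replay skips it: the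
    current vertex may be the only uncolored one of the clique. In all other moves from an uncolored
    vertex to color 0, a fresh color is spent, so the bound on the new set provides the
    room.\<close>
  proof (cases "p = 0 \<and> c = 0 \<and> d = 0")
    case True
    then show ?thesis using IH C by auto
  next
    case False
    have "card C + (if p = 0 then 1 else 0) < q" if "d = 0"
    proof (cases "p = 0")
      case True
      then have "card (insert c C - {0}) = Suc (card C)"
        using False that move.hyps(3) C by (auto simp: insert_Diff_if)
      then show ?thesis using move.prems True by simp
    qed (use \<open>card C < q\<close> in simp)
    then obtain w where "w < q" "step A (leafy_clique q m) (v, \<chi>) (w, \<chi>(v := c))"
      "realizes q (insert c C - {0}) d (w, \<chi>(v := c))"
      using realizes_step[OF alg IH(3) \<open>q + m = n\<close> move.hyps(2,3)] by metis
    then show ?thesis using reaches_step[OF IH(1)] IH(2) by fastforce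
  qed
qed

section \<open>Stopping or reusing a color too early is impossible\<close>

lemma clique_state_no_Stop:
  assumes alg: "is_algorithm A" and expl: "\<And>G. connected_graph G \<Longrightarrow> explores A G"
    and st: "clique_state A n C p" "Suc (card C) < n"
  shows "A p (clique_env n C p) \<noteq> Stop"
proof
  assume stop: "A p (clique_env n C p) = Stop"
  \<comment> \<open>One leaf per clique vertex: the same decision \<open>Stop\<close> is then taken
    while leaf \<open>q\<close> is unvisited.\<close>
  define q where "q = n - 1"
  have q: "card C < q" "q + 1 = n" using st by (auto simp: q_def)
  then obtain v \<chi> V where R: "reaches A (leafy_clique q 1) 0 (v, \<chi>) V" "V \<subseteq> {..<q}"
    "realizes q C p (v, \<chi>)" using clique_state_realized[OF alg st(1)] by (metis surj_pair)
  have "explores A (leafy_clique q 1)" using q by (intro expl connected_graph_leafy_clique) simp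
  moreover have "decide A (leafy_clique q 1) (v, \<chi>) = Stop"
    using clique_env_realizes[OF R(3) q(2)] stop by (rule trans)
  ultimately have "pverts (leafy_clique q 1) \<subseteq> V"
    using explores_Stop(2)[OF _ _ R(1)] q by simp
  moreover have "q \<in> pverts (leafy_clique q 1)" using q by simp
  ultimately show False using R(2) by (meson lessThan_iff less_irrefl subsetD)
qed

text \<open>Replayed on a clique with \<open>Suc (card C)\<close> vertices, the agent stands on the
  last uncolored one. Reusing \<open>c\<close> there completes the coloring of the clique with two
  vertices of equal color and no leaf visited, the situation of
  \<open>repeated_clique_color\<close>.\<close>

lemma clique_state_fresh_color:
  assumes alg: "is_algorithm A" and expl: "\<And>G. connected_graph G \<Longrightarrow> explores A G"
    and st: "clique_state A n C 0" "Suc (card C) < n" and cd: "A 0 (clique_env n C 0) = Go c d"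
  shows "c \<notin> C"
proof
  assume "c \<in> C"
  define q where "q = Suc (card C)"
  define m where "m = n - q"
  have q: "card C < q" "q + m = n" "0 < m" using st by (auto simp: q_def m_def)
  let ?G = "leafy_clique q m" and ?S = "\<lambda>\<chi>. {u. u < q \<and> \<chi> u \<noteq> (0::nat)}"
  obtain v \<chi> V where R: "reaches A ?G 0 (v, \<chi>) V" "V \<subseteq> {..<q}" "realizes q C 0 (v, \<chi>)"
    using clique_state_realized[OF alg st(1) q(1,2)] by (metis surj_pair)
  have expl: "explores A ?G" using q by (intro expl connected_graph_leafy_clique) simp
  have v: "v < q" "\<chi> v = 0" and bij: "bij_betw \<chi> (?S \<chi>) C" and leaf: "\<forall>w\<ge>q. \<chi> w = 0"
    using R(3) by (auto simp: realizes_def)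
  have c0: "c \<noteq> 0" using clique_state_set(2)[OF st(1)] \<open>c \<in> C\<close> by metis
  obtain a where a: "a < q" "\<chi> a = c" using bij \<open>c \<in> C\<close> by (auto simp: bij_betw_def)
  then have "a \<noteq> v" using v c0 by auto
  have "?S \<chi> = {..<q} - {v}"
  proof (rule card_subset_eq)
    show "card (?S \<chi>) = card ({..<q} - {v})" using v bij_betw_same_card[OF bij] by (simp add: q_def)
  qed (use v in auto)
  then have colored: "\<chi> u \<noteq> 0" if "u < q" "u \<noteq> v" for u using that by auto
  have dec: "decide A ?G (v, \<chi>) = Go c d" using clique_env_realizes[OF R(3) q(2)] cd by (rule trans)
  \<comment> \<open>On a request for \<open>c\<close> the agent is sent to \<open>a\<close>, and
    \<open>v\<close> becomes the avoided vertex. On any other request it does not reach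
    \<open>a\<close>, which is then the avoided one, though it may enter a leaf of
    \<open>v\<close>.\<close>
  define w where "w = (if d = c then a else (SOME w. (v, w) \<in> parcs ?G \<and> \<chi> w = d))"
  have w: "(v, w) \<in> parcs ?G" "\<chi> w = d" "d = c \<Longrightarrow> w = a"
  proof -
    have "(v, w) \<in> parcs ?G \<and> \<chi> w = d"
    proof (cases "d = c")
      case False
      then show ?thesis
        using someI_ex[OF decide_Go(1)[OF alg pair_graph_leafy_clique dec]] by (simp add: w_def)
    qed (use a v \<open>a \<noteq> v\<close> in \<open>simp add: w_def arc_clique_iff\<close>)
    then show "(v, w) \<in> parcs ?G" "\<chi> w = d" by auto
  qed (simp add: w_def)
  have step: "step A ?G (v, \<chi>) (w, \<chi>(v := c))" by (rule step.intros[OF dec w(1,2)])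
  have w_cases: "w < q \<and> w \<noteq> v \<or> w \<in> leaves q m v" using w(1) v(1) by (simp add: arc_clique_iff)
  have "w < q * Suc m" using w(1) by (simp add: leafy_clique_def)
  have R': "reaches A ?G 0 (w, \<chi>(v := c)) (insert w V)" using reaches_step[OF R(1) step] by simp
  have V: "V \<inter> leaves q m u = {}" for u using R(2) by (auto simp: leaves_def)
  have \<kappa>: "(\<chi>(v := c)) u \<noteq> 0" if "u < q" for u using colored that c0 by auto
  show False
  proof (cases "d = c")
    case True
    then have "w = a" using w(3) by simp
    show False
      by (rule repeated_clique_color[OF alg expl \<open>0 < m\<close> a(1) v(1) \<open>a \<noteq> v\<close> \<kappa> _ _ R'])
        (use a v \<open>a \<noteq> v\<close> V leaf \<open>w = a\<close> \<open>w < q * Suc m\<close> R(2) in \<open>auto simp: leaves_def\<close>)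
  next
    case False
    have "w \<noteq> a" "w mod q \<noteq> a"
      using False w(2) a w_cases \<open>a \<noteq> v\<close> by (auto simp: leaves_def)
    show False
      by (rule repeated_clique_color[OF alg expl \<open>0 < m\<close> v(1) a(1) not_sym[OF \<open>a \<noteq> v\<close>] \<kappa> _ _ R'])
        (use a v \<open>a \<noteq> v\<close> V leaf \<open>w \<noteq> a\<close> \<open>w mod q \<noteq> a\<close> w_cases
          \<open>w < q * Suc m\<close> R(2) in \<open>auto simp: leaves_def\<close>)
  qed
qed

section \<open>The lower bound on the complete graph\<close>

theorem theorem4:
  fixes A :: algorithm and n :: nat
  assumes "is_algorithm A"
    and "\<And>G. connected_graph G \<Longrightarrow> explores A G"
    and "n \<ge> 1"
  shows "\<exists>G. connected_graph G \<and> card (pverts G) = n \<and> uses_at_least A (n - 1) G"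
proof -
  \<comment> \<open>Without leaves this is the complete graph on \<open>n\<close> vertices.\<close>
  let ?G = "leafy_clique n 0"
  have G: "connected_graph ?G" using \<open>n \<ge> 1\<close> by (intro connected_graph_leafy_clique) simp
  have "\<exists>C p. clique_state A n C p \<and> card C = n - 1"
  proof (rule ccontr)
    assume none: "\<nexists>C p. clique_state A n C p \<and> card C = n - 1"
    \<comment> \<open>The number of colors grows by at most one per move, so it cannot pass n - 1
      without attaining it.\<close>
    have less: "Suc (card C) < n" if "clique_state A n C p" for C p
      using that
    proof induction
      case start
      show ?case using none clique_state.start[of A n] \<open>n \<ge> 1\<close> by (cases "n = 1") auto
    next
      case (move C p c d)
      have "card (insert c C - {0}) \<noteq> n - 1" using clique_state.move[OF move.hyps] none by blast
      moreover have "card (insert c C - {0}) \<le> Suc (card C)"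
        using card_Diff1_le[of "insert c C" 0] card_insert_le_m1[of "Suc (card C)" C c] by simp
      ultimately show ?case using move.IH by linarith
    qed
    \<comment> \<open>If n - 1 colors are never attained, at least two vertices of the complete
      graph stay uncolored, every decision is a move with a fresh color where one is due, and the
      run never ends.\<close>
    let ?P = "\<lambda>s. \<exists>C p. clique_state A n C p \<and> realizes n C p s"
    have closed: "\<exists>s'. step A ?G s s' \<and> ?P s'" if P: "?P s" for s
    proof -
      obtain v \<chi> where s: "s = (v, \<chi>)" by (cases s)
      obtain C p where st: "clique_state A n C p" and real: "realizes n C p (v, \<chi>)"
        using P s by blast
      obtain c d where cd: "A p (clique_env n C p) = Go c d"
        using clique_state_no_Stop[OF assms(1,2) st less[OF st]] by (cases "A p (clique_env n C p)") auto
      have fresh: "c \<notin> C" if "p = 0"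
        using clique_state_fresh_color[OF assms(1,2)] st less[OF st] cd that by blast
      obtain w where "step A ?G (v, \<chi>) (w, \<chi>(v := c))"
        "realizes n (insert c C - {0}) d (w, \<chi>(v := c))"
        by (rule realizes_step[OF assms(1) real _ cd fresh, of 0]) (use less[OF st] in auto)
      then show ?thesis using clique_state.move[OF st cd fresh] s by blast
    qed
    have "?P (0, \<lambda>_. 0)"
      using clique_state.start[of A n] \<open>n \<ge> 1\<close>
      by (intro exI[of _ "{}"] exI[of _ 0]) (auto simp: realizes_def bij_betw_def)
    then show False
      using explores_no_trap[OF assms(2)[OF G] _ reaches_start, of 0 ?P] closed \<open>n \<ge> 1\<close> by auto
  qed
  then obtain C p where C: "clique_state A n C p" "card C = n - 1" by blast
  \<comment> \<open>The replay applies with q = n because n - 1 < n.\<close>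
  then obtain v \<chi> V where "reaches A ?G 0 (v, \<chi>) V" "realizes n C p (v, \<chi>)"
    using clique_state_realized[OF assms(1) C(1), of n 0] \<open>n \<ge> 1\<close> by fastforce
  then have "uses_at_least A (card C) ?G"
    using \<open>n \<ge> 1\<close> clique_state_set[OF C(1)]
    by (intro uses_at_least_reaches[OF assms(1) pair_graph_leafy_clique])
      (auto simp: realizes_def bij_betw_def)
  then show ?thesis using G C(2) by (intro exI[of _ ?G]) simp
qed

end
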